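(* Let $\ell$ be a positive integer and let $P_n^{(\ell)}(x)$ denote either the higher-order Bernoulli polynomials $B_n^{(\ell)}(x)$ (for all $n$) or the higher-order Euler polynomials $E_n^{(\ell)}(x)$ (for all $n$). For $\alpha,x\in\mathbb C$ define $$\mathcal P_{\alpha,x}^{(\ell)}(z):=\sum_{k\ge0}\binom{\alpha}{k}P_k^{(\ell)}(x)z^k.$$ Then for every integer $r\ge0$ and every $h\in\mathbb C[[z]]$, $$[z^r]\,h(z)\mathcal P_{\alpha,x}^{(\ell)}(z)=[z^r]\,h\!\left(\frac{z}{1+z}\right)(1+z)^{r-1-\alpha}\,\mathcal P_{\alpha,\ell-1-x}^{(\ell)}(-z).$$
   Context: $[z^r]H(z)$ denotes the coefficient of $z^r$ in the formal power series $H(z)$. For $\beta\in\mathbb C$, $(1+z)^\beta:=\sum_{k\ge0}\binom{\beta}{k}z^k$. The higher-order Bernoulli and Euler polynomials are defined by $$\sum_{n\ge0}B_n^{(\ell)}(x)\frac{t^n}{n!}=\left(\frac{t}{e^t-1}\right)^\ell e^{xt},\qquad \sum_{n\ge0}E_n^{(\ell)}(x)\frac{t^n}{n!}=\left(\frac{2}{e^t+1}\right)^\ell e^{xt}.$$ *)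

theory Defs
  imports Complex_Main "HOL-Computational_Algebra.Formal_Power_Series"
begin

definition higher_bernoulli :: "nat \<Rightarrow> nat \<Rightarrow> complex \<Rightarrow> complex" where
  "higher_bernoulli l n x =
     fact n * fps_nth ((fps_X / (fps_exp 1 - 1)) ^ l * fps_exp x) n"

definition higher_euler :: "nat \<Rightarrow> nat \<Rightarrow> complex \<Rightarrow> complex" where
  "higher_euler l n x =
     fact n * fps_nth ((2 / (fps_exp 1 + 1)) ^ l * fps_exp x) n"

text \<open>The divisions above are divisions of formal power series. In the Bernoulli case the
  denominator is not a unit; the next two facts confirm that both quotients are exact.\<close>

lemma bernoulli_quotient_exact:
  "fps_X / (fps_exp 1 - 1) * (fps_exp 1 - 1) = (fps_X :: complex fps)"
proof -
  have nz: "fps_exp 1 - 1 \<noteq> (0 :: complex fps)"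
  proof
    assume "fps_exp 1 - 1 = (0 :: complex fps)"
    then have "fps_nth (fps_exp 1 - 1 :: complex fps) 1 = 0" by simp
    then show False by simp
  qed
  have "subdegree (fps_exp 1 - 1 :: complex fps) = 1"
    by (rule subdegreeI) auto
  then have "(fps_exp 1 - 1 :: complex fps) dvd fps_X"
    using nz by (simp add: fps_dvd_iff)
  then show ?thesis by simp
qed

lemma euler_quotient_exact:
  "2 / (fps_exp 1 + 1) * (fps_exp 1 + 1) = (2 :: complex fps)"
proof -
  have "(fps_exp 1 + 1 :: complex fps) dvd 1"
    by (simp add: fps_is_unit_iff)
  then have "(fps_exp 1 + 1 :: complex fps) dvd 2"
    using dvd_trans one_dvd by blast
  then show ?thesis by simp
qed

lemma higher_bernoulli_gf:
  "Abs_fps (\<lambda>n. higher_bernoulli l n x / fact n) = (fps_X / (fps_exp 1 - 1)) ^ l * fps_exp x"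
  by (rule fps_ext) (simp add: higher_bernoulli_def)

lemma higher_euler_gf:
  "Abs_fps (\<lambda>n. higher_euler l n x / fact n) = (2 / (fps_exp 1 + 1)) ^ l * fps_exp x"
  by (rule fps_ext) (simp add: higher_euler_def)

definition binomial_series ::
  "(nat \<Rightarrow> complex \<Rightarrow> complex) \<Rightarrow> complex \<Rightarrow> complex \<Rightarrow> complex fps" where
  "binomial_series P \<alpha> x = Abs_fps (\<lambda>k. (\<alpha> gchoose k) * P k x)"

end

theory Submission
  imports Defs
begin

unbundle fps_syntax

text \<open>By linearity in h it suffices to take h a monomial, where both sides are finite
  binomial sums. Reflection gives the identity \<open>(-1)^k P_k(l - 1 - x) = P_k(x + 1)\<close>, and
  the upper negation and trinomial revision identities for generalised binomial coefficients turn
  the right-hand side into a multiple of the binomial inversion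
  \<open>P_s(x) = (\<Sum>k\<le>s. (s choose k) (-1)^(s-k) P_k(x + 1))\<close>.\<close>

text \<open>This is the linearity in h. Since \<open>g ^ i\<close> has no terms below degree i, the
  inner sums of all coefficients up to r can be extended to the common range i \<le> r, and the two
  sums can then be exchanged.\<close>

lemma fps_compose_mult_nth:
  fixes f g F :: "'a::comm_ring_1 fps"
  assumes "g $ 0 = 0"
  shows "((f oo g) * F) $ r = (\<Sum>i\<le>r. f $ i * (g ^ i * F) $ r)"
proof -
  have "((f oo g) * F) $ r = (\<Sum>j\<le>r. (\<Sum>i\<le>r. f $ i * (g ^ i) $ j) * F $ (r - j))"
  proof -
    have "(f oo g) $ j = (\<Sum>i\<le>r. f $ i * (g ^ i) $ j)" if "j \<le> r" for j
      unfolding fps_compose_nth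
      using that by (intro sum.mono_neutral_left) (auto simp: startsby_zero_power_prefix[OF assms])
    then show ?thesis
      by (simp add: fps_mult_nth atLeast0AtMost)
  qed
  also have "\<dots> = (\<Sum>i\<le>r. \<Sum>j\<le>r. f $ i * (g ^ i) $ j * F $ (r - j))"
    unfolding sum_distrib_right by (rule sum.swap)
  also have "\<dots> = (\<Sum>i\<le>r. f $ i * (g ^ i * F) $ r)"
    by (simp add: fps_mult_nth atLeast0AtMost sum_distrib_left mult.assoc)
  finally show ?thesis .
qed

lemma fps_X_div_one_plus_X_power:
  "(fps_X / (1 + fps_X)) ^ i = (fps_X ^ i * fps_binomial (- of_nat i) :: 'a::field_char_0 fps)"
proof -
  have "fps_X / (1 + fps_X) = (fps_X * fps_binomial (- 1) :: 'a fps)"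
    by (simp add: fps_binomial_minus_one fps_divide_unit)
  then show ?thesis
    by (simp add: power_mult_distrib fps_binomial_power)
qed

text \<open>Upper negation turns the first factor into a signed
  \<open>(a - of_nat k) gchoose (s - k)\<close>, to which trinomial revision applies. The gain is
  that \<open>a gchoose s\<close> does not depend on k and can leave the convolution sum.\<close>

lemma gbinomial_negated_mult:
  fixes a :: "'a::field_char_0"
  assumes "k \<le> s"
  shows "((of_nat s - 1 - a) gchoose (s - k)) * (a gchoose k) =
    (a gchoose s) * ((- 1) ^ (s - k) * of_nat (s choose k))"
proof -
  have "(of_nat s - 1 - a) gchoose (s - k) = (- 1) ^ (s - k) * ((a - of_nat k) gchoose (s - k))"
    using assms by (subst gbinomial_negated_upper) (simp add: of_nat_diff algebra_simps)
  moreover have "(a gchoose s) * of_nat (s choose k) = (a gchoose k) * ((a - of_nat k) gchoose (s - k))"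
    using gbinomial_trinomial_revision[OF assms, of a] by (simp add: binomial_gbinomial)
  ultimately show ?thesis
    by (simp add: mult_ac)
qed

text \<open>Expand -t/(e^(-t) - 1) by e^t. As the denominator is not a unit, the argument works with
  the exact product \<open>?B * (?E - 1)\<close> and cancels the nonzero factor
  \<open>?E - 1\<close> only at the end.\<close>

lemma bernoulli_factor_reflection:
  "fps_compose (fps_X / (fps_exp 1 - 1)) (- fps_X) =
    (fps_X / (fps_exp 1 - 1) * fps_exp 1 :: complex fps)"
proof -
  let ?B = "fps_X / (fps_exp 1 - 1) :: complex fps"
  let ?E = "fps_exp 1 :: complex fps"
  have E: "fps_exp (- 1) * ?E = 1"
    by (simp flip: fps_exp_add_mult)
  have "(?B * (?E - 1)) oo (- fps_X) = fps_X oo (- fps_X)"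
    by (simp only: bernoulli_quotient_exact)
  then have "(?B oo (- fps_X)) * (fps_exp (- 1) - 1) = - fps_X"
    by (subst (asm) fps_compose_mult_distrib) (simp_all add: fps_compose_sub_distrib)
  then have "(?B oo (- fps_X)) * (fps_exp (- 1) * ?E - ?E) = - fps_X * ?E"
    by (metis left_diff_distrib mult.assoc mult_1)
  then have "(?B oo (- fps_X)) * (?E - 1) = fps_X * ?E"
    unfolding E by (simp add: algebra_simps)
  also have "\<dots> = ?B * ?E * (?E - 1)"
    by (metis bernoulli_quotient_exact mult.commute mult.left_commute)
  finally show ?thesis
    by simp
qed

lemma euler_factor_reflection:
  "fps_compose (2 / (fps_exp 1 + 1)) (- fps_X) =
    (2 / (fps_exp 1 + 1) * fps_exp 1 :: complex fps)"
proof -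
  let ?B = "2 / (fps_exp 1 + 1) :: complex fps"
  let ?E = "fps_exp 1 :: complex fps"
  have E: "fps_exp (- 1) * ?E = 1"
    by (simp flip: fps_exp_add_mult)
  \<comment> \<open>Otherwise exactness of the quotient would read 0 = 2.\<close>
  have nz: "?E + 1 \<noteq> 0"
    using euler_quotient_exact by force
  have "(?B * (?E + 1)) oo (- fps_X) = 2 oo (- fps_X)"
    by (simp only: euler_quotient_exact)
  then have "(?B oo (- fps_X)) * (fps_exp (- 1) + 1) = 2"
    by (subst (asm) fps_compose_mult_distrib) (simp_all add: fps_compose_add_distrib)
  then have "(?B oo (- fps_X)) * (fps_exp (- 1) * ?E + ?E) = 2 * ?E"
    by (metis distrib_right mult.assoc mult_1)
  then have "(?B oo (- fps_X)) * (?E + 1) = 2 * ?E"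
    unfolding E by (simp add: algebra_simps)
  also have "\<dots> = ?B * ?E * (?E + 1)"
    by (metis euler_quotient_exact mult.commute mult.left_commute)
  finally show ?thesis
    using nz by simp
qed

context
  fixes P :: "nat \<Rightarrow> complex \<Rightarrow> complex" and G :: "complex fps"
  assumes Appell: "P n x = fact n * (G * fps_exp x) $ n"
begin

text \<open>Passing from x + 1 back to x multiplies the exponential generating function by e^(-t);
  the sum is the resulting convolution, for any G.\<close>

lemma Appell_inversion:
  "(\<Sum>k\<le>s. (- 1) ^ (s - k) * of_nat (s choose k) * P k (x + 1)) = P s x"
proof -
  have "G * fps_exp x = G * fps_exp (x + 1) * fps_exp (- 1)"
    by (simp add: mult.assoc flip: fps_exp_add_mult)
  then have "(G * fps_exp x) $ s = (G * fps_exp (x + 1) * fps_exp (- 1)) $ s"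
    by (rule arg_cong)
  then have "P s x = fact s * (\<Sum>k\<le>s. (G * fps_exp (x + 1)) $ k * ((- 1) ^ (s - k) / fact (s - k)))"
    by (simp add: Appell fps_mult_nth[of _ "fps_exp (- 1)"] atLeast0AtMost)
  also have "\<dots> = (\<Sum>k\<le>s. (- 1) ^ (s - k) * of_nat (s choose k) * P k (x + 1))"
    unfolding sum_distrib_left
    by (intro sum.cong) (auto simp: Appell binomial_fact)
  finally show ?thesis ..
qed

text \<open>The hypothesis G(-t) = e^(lt) G(t) is all that the Bernoulli and Euler cases need to
  share beyond the Appell form.\<close>

lemma Appell_reflection:
  assumes "G oo (- fps_X) = G * fps_exp (of_nat l)"
  shows "(- 1) ^ k * P k (of_nat l - 1 - x) = P k (x + 1)"
proof -
  have "(G * fps_exp (of_nat l - 1 - x)) oo (- fps_X) = G * fps_exp (x + 1)"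
    by (simp add: fps_compose_mult_distrib assms mult.assoc flip: fps_exp_add_mult)
  then show ?thesis
    by (simp add: Appell fps_compose_uminus' fps_eq_iff mult.left_commute)
qed

lemma binomial_series_coefficient:
  "(fps_binomial (of_nat s - 1 - \<alpha>) * binomial_series P \<alpha> (x + 1)) $ s = (\<alpha> gchoose s) * P s x"
proof -
  have "(fps_binomial (of_nat s - 1 - \<alpha>) * binomial_series P \<alpha> (x + 1)) $ s =
      (\<Sum>k\<le>s. ((of_nat s - 1 - \<alpha>) gchoose (s - k)) * (\<alpha> gchoose k) * P k (x + 1))"
    unfolding mult.commute[of "fps_binomial _"] fps_mult_nth atLeast0AtMost
    by (simp add: binomial_series_def mult_ac)
  also have "\<dots> = (\<alpha> gchoose s) * (\<Sum>k\<le>s. (- 1) ^ (s - k) * of_nat (s choose k) * P k (x + 1))"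
    unfolding sum_distrib_left
    by (intro sum.cong) (simp_all add: gbinomial_negated_mult mult.assoc)
  finally show ?thesis
    by (simp only: Appell_inversion)
qed

lemma binomial_series_transformation:
  assumes "G oo (- fps_X) = G * fps_exp (of_nat l)"
  shows "(h * binomial_series P \<alpha> x) $ r =
    ((h oo (fps_X / (1 + fps_X))) * fps_binomial (of_nat r - 1 - \<alpha>)
      * (binomial_series P \<alpha> (of_nat l - 1 - x) oo (- fps_X))) $ r"
proof -
  let ?Q = "binomial_series P \<alpha> (x + 1)"
  let ?b = "fps_binomial (of_nat r - 1 - \<alpha>) :: complex fps"
  have Q: "binomial_series P \<alpha> (of_nat l - 1 - x) oo (- fps_X) = ?Q"
    by (rule fps_ext)
      (simp add: binomial_series_def fps_compose_uminus' mult.left_commute Appell_reflection[OF assms])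
  have g0: "(fps_X / (1 + fps_X) :: complex fps) $ 0 = 0"
    using fps_X_div_one_plus_X_power[of 1, where 'a = complex] by simp
  have "((h oo (fps_X / (1 + fps_X))) * (?b * ?Q)) $ r =
      (\<Sum>i\<le>r. h $ i * ((fps_X / (1 + fps_X)) ^ i * (?b * ?Q)) $ r)"
    by (rule fps_compose_mult_nth[OF g0])
  also have "\<dots> = (\<Sum>i\<le>r. h $ i * ((\<alpha> gchoose (r - i)) * P (r - i) x))"
  proof (intro sum.cong refl)
    fix i assume "i \<in> {..r}"
    then have i: "i \<le> r" by simp
    \<comment> \<open>The factor (1+z)^(-i) lowers the exponent r - 1 - \<alpha> by i, while z^i
      lowers the extracted degree by i. Both match s = r - i in
      \<open>binomial_series_coefficient\<close>, which is why the exponent involves r.\<close>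
    then have "fps_binomial (- of_nat i) * ?b = fps_binomial (of_nat (r - i) - 1 - \<alpha>)"
      by (simp add: of_nat_diff algebra_simps flip: fps_binomial_add_mult)
    then have "(fps_X / (1 + fps_X)) ^ i * (?b * ?Q) =
        fps_X ^ i * (fps_binomial (of_nat (r - i) - 1 - \<alpha>) * ?Q)"
      by (metis fps_X_div_one_plus_X_power mult.assoc)
    then have "((fps_X / (1 + fps_X)) ^ i * (?b * ?Q)) $ r =
        (fps_binomial (of_nat (r - i) - 1 - \<alpha>) * ?Q) $ (r - i)"
      using i by (simp only: fps_X_power_mult_nth not_less[symmetric] if_False)
    then show "h $ i * ((fps_X / (1 + fps_X)) ^ i * (?b * ?Q)) $ r =
        h $ i * ((\<alpha> gchoose (r - i)) * P (r - i) x)"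
      by (simp only: binomial_series_coefficient)
  qed
  also have "\<dots> = (h * binomial_series P \<alpha> x) $ r"
    by (simp add: fps_mult_nth binomial_series_def atLeast0AtMost)
  finally show ?thesis
    by (simp add: Q mult.assoc)
qed

end

theorem corollary5p2:
  fixes l r :: nat and \<alpha> x :: complex and h :: "complex fps"
    and P :: "nat \<Rightarrow> complex \<Rightarrow> complex"
  assumes "l > 0"
    and "P = higher_bernoulli l \<or> P = higher_euler l"
  shows "fps_nth (h * binomial_series P \<alpha> x) r =
    fps_nth (fps_compose h (fps_X / (1 + fps_X)) * fps_binomial (of_nat r - 1 - \<alpha>)
      * fps_compose (binomial_series P \<alpha> (of_nat l - 1 - x)) (- fps_X)) r"
  using assms(2)
proof
  assume "P = higher_bernoulli l"
  then show ?thesis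
    \<comment> \<open>The l-th power of the reflection for a single factor supplies
      \<open>fps_exp 1 ^ l\<close>, that is \<open>fps_exp (of_nat l)\<close>.\<close>
    by (intro binomial_series_transformation[where G = "(fps_X / (fps_exp 1 - 1)) ^ l"])
      (simp_all add: higher_bernoulli_def fps_compose_power[symmetric] bernoulli_factor_reflection
        power_mult_distrib fps_exp_power_mult)
next
  assume "P = higher_euler l"
  then show ?thesis
    by (intro binomial_series_transformation[where G = "(2 / (fps_exp 1 + 1)) ^ l"])
      (simp_all add: higher_euler_def fps_compose_power[symmetric] euler_factor_reflection
        power_mult_distrib fps_exp_power_mult)
qed

end
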